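(* Let $\mathbf U^{( * )}=(\mathcal E^{( * )},\mathcal F^{( * )}_\mu)$ be realizable, with hat moments $\widehat{\mathcal E}^{( * )}=W(\mathcal E^{( * )}-v^k\mathcal F^{( * )}_k)$, $\widehat{\mathcal F}^{( * )}_i=\mathcal F^{( * )}_i-W^2v_i(\mathcal E^{( * )}-v^k\mathcal F^{( * )}_k)$, and assume that $\mathbf M^{[k]}=(\mathcal J^{[k]},\mathcal H^{[k]}_\mu)$ is realizable. Let $\mathbf M^{[k+1]}=(\mathcal J^{[k+1]},\mathcal H^{[k+1]}_\mu)$ be given by the Picard iteration $$\mathcal J^{[k+1]}=\mathcal J^{[k]}-\lambda\mu_\chi\big[W\mathcal J^{[k]}+v^i\mathcal H^{[k]}_i-\widehat{\mathcal E}^{( * )}-\Delta\tau\,\chi(\mathcal J_{\rm Eq}-\mathcal J^{[k]})\big],$$ $$\mathcal H_j^{[k+1]}=\mathcal H_j^{[k]}-\lambda\mu_\kappa\big[W\mathcal H^{[k]}_j+v^i\mathcal K^{[k]}_{ij}-\widehat{\mathcal F}_j^{( * )}+\Delta\tau\,\kappa\,\mathcal H_j^{[k]}\big],\qquad \mathcal H^{[k+1]}_0=-v^i\mathcal H_i^{[k+1]},$$ where $\mu_\chi=(W+\lambda\Delta\tau\chi)^{-1}$, $\mu_\kappa=(W+\lambda\Delta\tau\kappa)^{-1}$ and $0<\lambda\le(1+v)^{-1}$. Then $\mathbf M^{[k+1]}$ is realizable.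
   Context: $v^i\in\mathbb R^3$ is a three-velocity with $v=\sqrt{v_iv^i}<1$, $W=(1-v^2)^{-1/2}$, $u^\mu=W(1,v^i)$, metric $\eta=\mathrm{diag}(-1,1,1,1)$, Latin indices $1..3$. $\Delta\tau\ge0$ is a step size, $\chi$ the absorption opacity, $\kappa=\chi+\sigma$ the total opacity with $0\le\chi\le\kappa$, and $\mathcal J_{\rm Eq}\ge0$ the equilibrium density. A pair $(a,b_\mu)$ is realizable if $a>0$ and $a\ge\sqrt{b_\mu b^\mu}$. For the Eulerian pair $(\mathcal E,\mathcal F_\mu)$ one has $\mathcal F_0=0$; for the Lagrangian and hat pairs the covectors are orthogonal to $u^\mu$: $\mathcal H_0=-v^i\mathcal H_i$, $\widehat{\mathcal F}_0=-v^i\widehat{\mathcal F}_i$. For $\omega=(\vartheta,\varphi)\in\mathbb S^2$ put $\ell^{\hat\imath}=(\cos\vartheta,\sin\vartheta\cos\varphi,\sin\vartheta\sin\varphi)$ and $\ell^0=Wv_j\ell^{\hat\jmath}$, $\ell^i=\ell^{\hat\imath}+(W-1)v^i(v_j\ell^{\hat\jmath})/v^2$ ($\ell^i=\ell^{\hat\imath}$ if $v=0$); then $u_\mu\ell^\mu=0$ and $\ell_\mu\ell^\mu=1$. Exact closure assumption (standing): there is an $f^{[k]}\ge0$ on $\mathbb S^2$, integrable with positive integral, such that, with $\varepsilon>0$ the particle energy, $\mathcal J^{[k]}=\frac{\varepsilon}{4\pi}\int f^{[k]}d\omega$, $\mathcal H_\mu^{[k]}=\frac{\varepsilon}{4\pi}\int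 f^{[k]}\ell_\mu d\omega$, $\mathcal K_{\mu\nu}^{[k]}=\frac{\varepsilon}{4\pi}\int f^{[k]}\ell_\mu\ell_\nu d\omega$. *)

theory Defs
  imports "HOL-Analysis.Analysis"
begin

text \<open>
  Spatial indices have type \<^typ>\<open>3\<close>.  Spacetime indices have type \<^typ>\<open>3 option\<close>: \<^term>\<open>None\<close> is the
  time index 0 and \<^term>\<open>Some i\<close> the spatial index \<open>i\<close>.  Spatial indices are raised and lowered
  with the identity, so \<open>v_i = v^i\<close> and \<open>sqrt (v_i v^i)\<close> is the Euclidean norm of \<open>v\<close>.
\<close>

type_synonym spacevec = "real ^ 3"
type_synonym fourvec = "real ^ (3 option)"
type_synonym fourtensor = "real ^ (3 option) ^ (3 option)"

text \<open>As \<open>minkowski\<close> is its own inverse, \<open>minkowski *v b\<close> both raises and lowers the index of \<open>b\<close>.\<close>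

definition minkowski :: fourtensor where
  "minkowski = (\<chi> \<mu> \<nu>. if \<mu> \<noteq> \<nu> then 0 else if \<mu> = None then -1 else 1)"

definition lorentz :: "spacevec \<Rightarrow> real" where
  "lorentz v = 1 / sqrt (1 - (norm v)\<^sup>2)"

definition spatial :: "fourvec \<Rightarrow> spacevec" where
  "spatial b = (\<chi> i. b $ Some i)"

text \<open>\<open>b_\<mu> u^\<mu> = 0\<close> for \<open>u = lorentz v (1, v)\<close>, written in components.\<close>

definition orth_u :: "spacevec \<Rightarrow> fourvec \<Rightarrow> bool" where
  "orth_u v b \<longleftrightarrow> b $ None = - (v \<bullet> spatial b)"

definition realizable :: "real \<Rightarrow> fourvec \<Rightarrow> bool" where
  "realizable a b \<longleftrightarrow> a > 0 \<and> a \<ge> sqrt (b \<bullet> (minkowski *v b))"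

definition hat_energy :: "spacevec \<Rightarrow> real \<Rightarrow> fourvec \<Rightarrow> real" where
  "hat_energy v E F = lorentz v * (E - v \<bullet> spatial F)"

definition hat_flux :: "spacevec \<Rightarrow> real \<Rightarrow> fourvec \<Rightarrow> fourvec" where
  "hat_flux v E F =
    (let Fs = spatial F - ((lorentz v)\<^sup>2 * (E - v \<bullet> spatial F)) *\<^sub>R v
     in \<chi> \<mu>. case \<mu> of None \<Rightarrow> - (v \<bullet> Fs) | Some i \<Rightarrow> Fs $ i)"

text \<open>
  Points of the unit sphere are given by their angles \<open>(\<theta>, \<phi>)\<close>, the polar axis being the first
  coordinate axis; \<open>solid_angle\<close> is the surface measure \<open>d\<omega> = sin \<theta> d\<theta> d\<phi>\<close>.
\<close>

definition angles :: "(real \<times> real) set" where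
  "angles = {0..pi} \<times> {0..<2 * pi}"

definition solid_angle :: "(real \<times> real) measure" where
  "solid_angle = density (restrict_space lborel angles) (\<lambda>(\<theta>, \<phi>). ennreal (sin \<theta>))"

definition direction :: "real \<times> real \<Rightarrow> spacevec" where
  "direction = (\<lambda>(\<theta>, \<phi>). vector [cos \<theta>, sin \<theta> * cos \<phi>, sin \<theta> * sin \<phi>])"

definition ell :: "spacevec \<Rightarrow> real \<times> real \<Rightarrow> fourvec" where
  "ell v \<omega> = (\<chi> \<mu>. case \<mu> of
      None \<Rightarrow> lorentz v * (v \<bullet> direction \<omega>)
    | Some i \<Rightarrow> if v = 0 then direction \<omega> $ i
        else direction \<omega> $ i + (lorentz v - 1) * v $ i * (v \<bullet> direction \<omega>) / (norm v)\<^sup>2)"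

definition ell_low :: "spacevec \<Rightarrow> real \<times> real \<Rightarrow> fourvec" where
  "ell_low v \<omega> = minkowski *v ell v \<omega>"

definition exact_closure ::
  "spacevec \<Rightarrow> real \<Rightarrow> real \<Rightarrow> fourvec \<Rightarrow> fourtensor \<Rightarrow> bool" where
  "exact_closure v \<epsilon> J H K \<longleftrightarrow>
    (\<exists>f :: real \<times> real \<Rightarrow> real.
       (\<forall>\<omega>\<in>angles. f \<omega> \<ge> 0) \<and>
       integrable solid_angle f \<and>
       (\<integral>\<omega>. f \<omega> \<partial>solid_angle) > 0 \<and>
       J = \<epsilon> / (4 * pi) * (\<integral>\<omega>. f \<omega> \<partial>solid_angle) \<and>
       (\<forall>\<mu>. H $ \<mu> = \<epsilon> / (4 * pi) * (\<integral>\<omega>. f \<omega> * ell_low v \<omega> $ \<mu> \<partial>solid_angle)) \<and>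
       (\<forall>\<mu> \<nu>. K $ \<mu> $ \<nu> =
          \<epsilon> / (4 * pi) * (\<integral>\<omega>. f \<omega> * ell_low v \<omega> $ \<mu> * ell_low v \<omega> $ \<nu> \<partial>solid_angle)))"

end

theory Submission
  imports Defs
begin

text \<open>
  On the covectors orthogonal to \<open>u\<close> the Minkowski form is positive definite: it is the Euclidean
  norm of the spatial part after the linear map \<open>rest_frame v\<close>, the inverse of the map that sends
  \<open>direction \<omega>\<close> to the spatial part of \<open>ell v \<omega>\<close>.  Clearing the denominators, the Picard step reads
  \<open>(W + \<lambda> \<Delta>\<tau> \<chi>) J' = \<integral> g + \<lambda> (\<E> + \<Delta>\<tau> \<chi> J_Eq)\<close> and \<open>(W + \<lambda> \<Delta>\<tau> \<kappa>) H' = \<integral> g \<ell> + \<lambda> \<F>\<close>, where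
  \<open>(\<E>, \<F>)\<close> are the hat moments and \<open>g = \<epsilon> / (4 \<pi>) f W (1 - \<lambda> (1 + v \<bullet> direction))\<close> is nonnegative
  precisely because \<open>\<lambda> \<le> 1 / (1 + |v|)\<close>.  Both summands of \<open>H'\<close> are dominated by those of \<open>J'\<close>, and
  the larger denominator of \<open>H'\<close> only helps.
\<close>

text \<open>This is the spatial part of the Lorentz boost to the rest frame, applied to a covector
  whose time component is \<open>- (v \<bullet> h)\<close>. For nonzero \<open>v\<close> the factor
  W / (W + 1) equals (W - 1) / (W |v|^2); the form chosen has no division by |v|.\<close>

definition rest_frame :: "spacevec \<Rightarrow> spacevec \<Rightarrow> spacevec" where
  "rest_frame v h = h - (lorentz v / (lorentz v + 1) * (v \<bullet> h)) *\<^sub>R v"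

lemma bounded_linear_rest_frame: "bounded_linear (rest_frame v)"
  unfolding rest_frame_def
  by (intro bounded_linear_sub bounded_linear_ident bounded_linear_scaleR_const
      bounded_linear_mult_const bounded_linear_const_mult bounded_linear_inner_right)

section \<open>The Lorentz factor and norms in the rest frame\<close>

lemma lorentz_ge_1:
  assumes "norm v < 1"
  shows "1 \<le> lorentz v"
proof -
  have "0 < 1 - (norm v)\<^sup>2" using assms by (simp add: power_less_one_iff)
  then show ?thesis by (simp add: lorentz_def)
qed

lemma lorentz_square:
  assumes "norm v < 1"
  shows "(lorentz v)\<^sup>2 * (1 - (norm v)\<^sup>2) = 1"
proof -
  have "0 < 1 - (norm v)\<^sup>2" using assms by (simp add: power_less_one_iff)
  then show ?thesis by (simp add: lorentz_def power_divide)
qed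

lemma norm_rest_frame_square:
  assumes "norm v < 1"
  shows "(norm (rest_frame v h))\<^sup>2 = (norm h)\<^sup>2 - (v \<bullet> h)\<^sup>2"
proof -
  define W where "W = lorentz v"
  define c where "c = W / (W + 1)"
  have W: "W \<ge> 1" "W\<^sup>2 * (1 - v \<bullet> v) = 1"
    using lorentz_ge_1[OF assms] lorentz_square[OF assms] by (simp_all add: W_def power2_norm_eq_inner)
  have c: "c * (W + 1) = W" using W by (simp add: c_def)
  \<comment> \<open>Expanding the square of the norm leaves
    \<open>c\<^sup>2 * (v \<bullet> v) - 2 * c\<close> as the coefficient of
    \<open>(v \<bullet> h)\<^sup>2\<close>, so \<open>c\<close> must be a root of a quadratic.
    Scaling by (W + 1)^2 makes this polynomial in W.\<close>
  have "(W + 1)\<^sup>2 * (c\<^sup>2 * (v \<bullet> v) - 2 * c + 1) = (c * (W + 1))\<^sup>2 * (v \<bullet> v) - 2 * (c * (W + 1)) * (W + 1) + (W + 1)\<^sup>2"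
    by (simp add: power2_eq_square algebra_simps)
  also have "\<dots> = 1 - W\<^sup>2 * (1 - v \<bullet> v)"
    unfolding c by (simp add: power2_eq_square algebra_simps)
  also have "\<dots> = 0" unfolding W(2) by simp
  finally have c2: "c\<^sup>2 * (v \<bullet> v) = 2 * c - 1" using W by simp
  have "(norm (rest_frame v h))\<^sup>2 = h \<bullet> h - 2 * c * (v \<bullet> h)\<^sup>2 + c\<^sup>2 * (v \<bullet> v) * (v \<bullet> h)\<^sup>2"
    unfolding power2_norm_eq_inner rest_frame_def W_def[symmetric] c_def[symmetric]
    by (simp add: inner_diff_left inner_diff_right inner_commute power2_eq_square algebra_simps)
  also have "\<dots> = (norm h)\<^sup>2 - (v \<bullet> h)\<^sup>2"
    unfolding c2 power2_norm_eq_inner by (simp add: algebra_simps)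
  finally show ?thesis .
qed

section \<open>The Minkowski form and realizability\<close>

lemma minkowski_mult_nth:
  "(minkowski *v b) $ \<mu> = (if \<mu> = None then - b $ \<mu> else b $ \<mu>)"
proof -
  have "(minkowski *v b) $ \<mu> = (\<Sum>\<nu>\<in>UNIV. if \<mu> = \<nu> then (if \<mu> = None then -1 else 1) * b $ \<nu> else 0)"
    unfolding matrix_vector_mult_def minkowski_def vec_lambda_beta by (intro sum.cong) auto
  then show ?thesis by simp
qed

lemma inner_minkowski:
  "b \<bullet> (minkowski *v b) = (norm (spatial b))\<^sup>2 - (b $ None)\<^sup>2"
proof -
  have "b \<bullet> (minkowski *v b) = (\<Sum>\<mu>\<in>UNIV. (if \<mu> = None then -1 else 1) * (b $ \<mu>)\<^sup>2)"
    unfolding inner_vec_def minkowski_mult_nth by (auto intro!: sum.cong simp: power2_eq_square)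
  also have "\<dots> = (\<Sum>i\<in>UNIV. (b $ Some i)\<^sup>2) - (b $ None)\<^sup>2"
    by (simp add: UNIV_option_conv sum.reindex)
  also have "(\<Sum>i\<in>UNIV. (b $ Some i)\<^sup>2) = (norm (spatial b))\<^sup>2"
    unfolding power2_norm_eq_inner by (simp add: inner_vec_def spatial_def power2_eq_square)
  finally show ?thesis .
qed

text \<open>With the norm of a linear image in place of the square root of an indefinite form, the
  triangle inequality and the norm bound for integrals become available.\<close>

lemma realizable_orth_iff:
  assumes "norm v < 1" "orth_u v b"
  shows "realizable a b \<longleftrightarrow> 0 < a \<and> norm (rest_frame v (spatial b)) \<le> a"
proof -
  have "b \<bullet> (minkowski *v b) = (norm (rest_frame v (spatial b)))\<^sup>2"
    using assms by (simp add: inner_minkowski norm_rest_frame_square orth_u_def)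
  then show ?thesis by (simp add: realizable_def)
qed

lemma spatial_minkowski_mult: "spatial (minkowski *v b) = spatial b"
  by (simp add: spatial_def minkowski_mult_nth)

section \<open>Directions and the vectors \<open>ell\<close>\<close>

lemma norm_direction: "norm (direction \<omega>) = 1"
proof (cases \<omega>)
  case (Pair \<theta> \<phi>)
  have "direction \<omega> \<bullet> direction \<omega> = (cos \<theta>)\<^sup>2 + (sin \<theta> * cos \<phi>)\<^sup>2 + (sin \<theta> * sin \<phi>)\<^sup>2"
    by (simp add: Pair direction_def inner_vec_def sum_3 power2_eq_square)
  also have "\<dots> = (cos \<theta>)\<^sup>2 + (sin \<theta>)\<^sup>2 * ((cos \<phi>)\<^sup>2 + (sin \<phi>)\<^sup>2)"
    by (simp only: power_mult_distrib distrib_left add.assoc)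
  finally show ?thesis by (simp add: norm_eq_1)
qed

text \<open>The case split in \<open>ell\<close> disappears because the correction is a multiple of
  \<open>v\<close>, hence zero when \<open>v = 0\<close>.\<close>

lemma spatial_ell_low:
  "spatial (ell_low v \<omega>) =
     direction \<omega> + ((lorentz v - 1) * (v \<bullet> direction \<omega>) / (norm v)\<^sup>2) *\<^sub>R v"
  unfolding ell_low_def spatial_minkowski_mult
  by (simp add: vec_eq_iff spatial_def ell_def)

lemma inner_spatial_ell_low:
  "v \<bullet> spatial (ell_low v \<omega>) = lorentz v * (v \<bullet> direction \<omega>)"
  unfolding spatial_ell_low
  by (cases "v = 0")
    (simp_all add: inner_add_right power2_norm_eq_inner, simp add: algebra_simps)

lemma rest_frame_ell_low:
  assumes "norm v < 1"
  shows "rest_frame v (spatial (ell_low v \<omega>)) = direction \<omega>"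
proof -
  define W where "W = lorentz v"
  define p where "p = v \<bullet> direction \<omega>"
  have W: "W \<ge> 1" "W\<^sup>2 * (1 - (norm v)\<^sup>2) = 1"
    using lorentz_ge_1[OF assms] lorentz_square[OF assms] by (simp_all add: W_def)
  \<comment> \<open>This is W^2 |v|^2 = (W - 1) (W + 1) times p, stated without quotients so that it
    also holds at \<open>v = 0\<close>.\<close>
  have "(W - 1) * p * (W + 1) = W * (W * p) * (norm v)\<^sup>2"
    using W(2) by algebra
  then have "(W - 1) * p / (norm v)\<^sup>2 = W / (W + 1) * (W * p)" if "v \<noteq> 0"
    using that W(1) by (simp add: frac_eq_eq)
  then show ?thesis
    unfolding rest_frame_def inner_spatial_ell_low
    unfolding spatial_ell_low W_def[symmetric] p_def[symmetric]
    by (cases "v = 0") simp_all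
qed

section \<open>The hat moments\<close>

lemma spatial_hat_flux:
  "spatial (hat_flux v E F) =
     spatial F - ((lorentz v)\<^sup>2 * (E - v \<bullet> spatial F)) *\<^sub>R v"
  by (simp add: hat_flux_def Let_def spatial_def vec_eq_iff)

text \<open>The change of frame preserves the invariant: the squared hat energy minus the squared
  rest-frame norm of the hat flux is E^2 - |F|^2, which is nonnegative. Positivity of the hat energy
  is Cauchy-Schwarz together with |v| < 1.\<close>

lemma hat_moments_realizable:
  assumes v: "norm v < 1" and F0: "F $ None = 0" and real: "realizable E F"
  shows "0 < hat_energy v E F"
    and "norm (rest_frame v (spatial (hat_flux v E F))) \<le> hat_energy v E F"
proof -
  define W where "W = lorentz v"
  define p where "p = v \<bullet> spatial F"
  have W: "W \<ge> 1" "W\<^sup>2 * (1 - v \<bullet> v) = 1"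
    using lorentz_ge_1[OF v] lorentz_square[OF v] by (simp_all add: W_def power2_norm_eq_inner)
  have E: "0 < E" "norm (spatial F) \<le> E"
    using real F0 by (simp_all add: realizable_def inner_minkowski)
  have "p \<le> norm v * norm (spatial F)"
    unfolding p_def by (rule norm_cauchy_schwarz)
  also have "\<dots> \<le> norm v * E" using E by (simp add: mult_left_mono)
  also have "\<dots> < E" using v E by simp
  finally have pE: "p < E" .
  then show pos: "0 < hat_energy v E F"
    unfolding hat_energy_def W_def[symmetric] p_def[symmetric] using W by simp
  define a where "a = E - p"
  \<comment> \<open>The factors \<open>W\<^sup>2 * (1 - v \<bullet> v)\<close> are kept visible, so
    that the expansion is a polynomial identity and each of them can then be replaced by 1.\<close>
  have "(norm (rest_frame v (spatial (hat_flux v E F))))\<^sup>2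
      = (norm (spatial F))\<^sup>2 - p\<^sup>2 - 2 * a * p * (W\<^sup>2 * (1 - v \<bullet> v))
        + (W\<^sup>2 * (1 - v \<bullet> v)) * W\<^sup>2 * a\<^sup>2 * (v \<bullet> v)"
    unfolding norm_rest_frame_square[OF v]
    unfolding spatial_hat_flux W_def[symmetric] p_def[symmetric] a_def[symmetric] power2_norm_eq_inner
    by (simp add: inner_diff_left inner_diff_right p_def inner_commute power2_eq_square algebra_simps)
  also have "\<dots> = (norm (spatial F))\<^sup>2 - p\<^sup>2 - 2 * a * p + W\<^sup>2 * a\<^sup>2 * (v \<bullet> v)"
    unfolding W(2) by simp
  also have "W\<^sup>2 * a\<^sup>2 * (v \<bullet> v) = W\<^sup>2 * a\<^sup>2 - W\<^sup>2 * (1 - v \<bullet> v) * a\<^sup>2"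
    by (simp add: algebra_simps)
  also have "\<dots> = W\<^sup>2 * a\<^sup>2 - a\<^sup>2"
    unfolding W(2) by simp
  also have "(norm (spatial F))\<^sup>2 - p\<^sup>2 - 2 * a * p + (W\<^sup>2 * a\<^sup>2 - a\<^sup>2)
      = (norm (spatial F))\<^sup>2 - E\<^sup>2 + W\<^sup>2 * a\<^sup>2"
    unfolding a_def by (simp add: power2_eq_square algebra_simps)
  also have "\<dots> \<le> (W * a)\<^sup>2"
    using E by (simp add: power_mult_distrib)
  finally have "(norm (rest_frame v (spatial (hat_flux v E F))))\<^sup>2 \<le> (hat_energy v E F)\<^sup>2"
    unfolding hat_energy_def W_def[symmetric] p_def[symmetric] a_def[symmetric] .
  then show "norm (rest_frame v (spatial (hat_flux v E F))) \<le> hat_energy v E F"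
    by (rule power2_le_imp_le) (use pos in simp)
qed

text \<open>The closure asserts integrability of \<open>f\<close> alone. Boundedness of the
  directional factors extends it to all moment densities, as linearity of the Bochner integral
  requires.\<close>

lemma integrable_scaleR_bounded:
  fixes f :: "'a \<Rightarrow> real" and b :: "'a \<Rightarrow> 'b :: {banach, second_countable_topology}"
  assumes "integrable M f" "b \<in> borel_measurable M" "\<And>x. norm (b x) \<le> B"
  shows "integrable M (\<lambda>x. f x *\<^sub>R b x)"
proof (rule Bochner_Integration.integrable_bound)
  show "integrable M (\<lambda>x. f x * B)" using assms(1) by simp
  show "AE x in M. norm (f x *\<^sub>R b x) \<le> norm (f x * B)"
  proof (rule AE_I2)
    fix x
    have "norm (b x) \<le> \<bar>B\<bar>" using assms(3)[of x] by linarith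
    then show "norm (f x *\<^sub>R b x) \<le> norm (f x * B)"
      by (simp add: abs_mult mult_left_mono)
  qed
qed (use assms(1,2) in measurable)

section \<open>The measure \<open>solid_angle\<close>\<close>

lemma borel_measurable_direction: "direction \<in> borel_measurable solid_angle"
proof -
  have "continuous_on UNIV (\<lambda>\<omega>. direction \<omega> $ i)" for i
    using exhaust_3[of i]
    by (elim disjE; simp add: direction_def case_prod_unfold; intro continuous_intros)
  then have "continuous_on UNIV direction"
    using continuous_on_vec_lambda[of UNIV "\<lambda>i \<omega>. direction \<omega> $ i"] by simp
  then have "direction \<in> borel_measurable (restrict_space lborel angles)"
    by (intro measurable_restrict_space1) (simp add: borel_measurable_continuous_onI)
  then show ?thesis by (simp add: solid_angle_def cong: measurable_cong_sets)
qed

lemma space_solid_angle: "space solid_angle = angles"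
  by (simp add: solid_angle_def space_restrict_space)

section \<open>Realizability of the Picard iterate\<close>

theorem lemma11:
  fixes v :: "real ^ 3"
    and W dtau chi sigma kappa J_Eq \<epsilon> lam mu_chi mu_kappa :: real
    and E :: real and F :: fourvec
    and J J' :: real and H H' :: fourvec and K :: fourtensor
  assumes v_less_1: "norm v < 1"
    and W_eq: "W = lorentz v"
    and dtau_nonneg: "0 \<le> dtau"
    and kappa_eq: "kappa = chi + sigma"
    and opacities: "0 \<le> chi" "chi \<le> kappa"
    and J_Eq_nonneg: "0 \<le> J_Eq"
    and energy: "0 < \<epsilon>"
    and eulerian: "F $ None = 0"
    and realizable_U: "realizable E F"
    and lagrangian: "orth_u v H"
    and realizable_M: "realizable J H"
    and closure: "exact_closure v \<epsilon> J H K"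
    and mu_chi_eq: "mu_chi = inverse (W + lam * dtau * chi)"
    and mu_kappa_eq: "mu_kappa = inverse (W + lam * dtau * kappa)"
    and lambda: "0 < lam" "lam \<le> inverse (1 + norm v)"
    and picard_J: "J' = J - lam * mu_chi *
      (W * J + v \<bullet> spatial H - hat_energy v E F - dtau * chi * (J_Eq - J))"
    and picard_H: "\<And>j. H' $ Some j = H $ Some j - lam * mu_kappa *
      (W * H $ Some j + (\<Sum>i\<in>UNIV. v $ i * K $ Some i $ Some j)
        - hat_flux v E F $ Some j + dtau * kappa * H $ Some j)"
    and picard_H0: "H' $ None = - (\<Sum>i\<in>UNIV. v $ i * H' $ Some i)"
  shows "realizable J' H'"
proof -
  obtain f where f_nonneg: "\<And>\<omega>. \<omega> \<in> angles \<Longrightarrow> 0 \<le> f \<omega>"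
    and f_int: "integrable solid_angle f"
    and J_eq: "J = \<epsilon> / (4 * pi) * (\<integral>\<omega>. f \<omega> \<partial>solid_angle)"
    and H_eq: "\<And>\<mu>. H $ \<mu> = \<epsilon> / (4 * pi) * (\<integral>\<omega>. f \<omega> * ell_low v \<omega> $ \<mu> \<partial>solid_angle)"
    and K_eq: "\<And>\<mu> \<nu>. K $ \<mu> $ \<nu> =
      \<epsilon> / (4 * pi) * (\<integral>\<omega>. f \<omega> * ell_low v \<omega> $ \<mu> * ell_low v \<omega> $ \<nu> \<partial>solid_angle)"
    using closure unfolding exact_closure_def by blast
  define e where "e \<omega> = spatial (ell_low v \<omega>)" for \<omega>
  define c where "c = \<epsilon> / (4 * pi)"
  define g where "g \<omega> = c * (f \<omega> * (W * (1 - lam * (1 + v \<bullet> direction \<omega>))))" for \<omega>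
  have c: "0 \<le> c" using energy by (simp add: c_def)
  have W: "1 \<le> W" using lorentz_ge_1[OF v_less_1] by (simp add: W_eq)
  note [measurable] = borel_measurable_direction
  have e_alt: "e \<omega> = direction \<omega> + ((W - 1) * (v \<bullet> direction \<omega>) / (norm v)\<^sup>2) *\<^sub>R v" for \<omega>
    by (simp add: e_def spatial_ell_low W_eq)
  have e_meas[measurable]: "e \<in> borel_measurable solid_angle"
    unfolding e_alt[abs_def] by measurable
  have vd: "\<bar>v \<bullet> direction \<omega>\<bar> \<le> norm v" for \<omega>
    using Cauchy_Schwarz_ineq2[of v "direction \<omega>"] by (simp add: norm_direction)
  obtain B where B: "\<And>\<omega>. norm (e \<omega>) \<le> B"
  proof
    fix \<omega>
    have "norm (e \<omega>) \<le> 1 + \<bar>(W - 1) * (v \<bullet> direction \<omega>) / (norm v)\<^sup>2\<bar> * norm v"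
      unfolding e_alt by (rule order_trans[OF norm_triangle_ineq]) (simp add: norm_direction)
    also have "\<dots> \<le> 1 + (W - 1) * norm v / (norm v)\<^sup>2 * norm v"
      using W vd[of \<omega>]
      by (auto simp: abs_mult intro!: mult_right_mono divide_right_mono mult_left_mono)
    finally show "norm (e \<omega>) \<le> 1 + (W - 1) * norm v / (norm v)\<^sup>2 * norm v" .
  qed
  have e_comp: "ell_low v \<omega> $ Some i = e \<omega> $ i" for \<omega> i by (simp add: e_def spatial_def)
  have ve: "v \<bullet> e \<omega> = W * (v \<bullet> direction \<omega>)" for \<omega>
    by (simp add: e_def inner_spatial_ell_low W_eq)
  have int_fe: "integrable solid_angle (\<lambda>\<omega>. f \<omega> *\<^sub>R e \<omega>)"
    using f_int e_meas B by (rule integrable_scaleR_bounded)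
  have int_fve: "integrable solid_angle (\<lambda>\<omega>. f \<omega> * (v \<bullet> e \<omega>))"
    using integrable_bounded_linear[OF bounded_linear_inner_right int_fe, of v] by simp
  have int_fvee: "integrable solid_angle (\<lambda>\<omega>. (f \<omega> * (v \<bullet> e \<omega>)) *\<^sub>R e \<omega>)"
    using int_fve e_meas B by (rule integrable_scaleR_bounded)
  \<comment> \<open>The closure gives the moments componentwise; \<open>comp\<close> passes to
    vector-valued integrals, to which \<open>rest_frame v\<close> can be applied.\<close>
  have comp: "(\<integral>\<omega>. h \<omega> \<partial>solid_angle) $ i = (\<integral>\<omega>. h \<omega> $ i \<partial>solid_angle)"
    if "integrable solid_angle h" for h :: "real \<times> real \<Rightarrow> spacevec" and i
    using integral_bounded_linear[OF bounded_linear_vec_nth that] by simp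
  have Hs: "spatial H = c *\<^sub>R (\<integral>\<omega>. f \<omega> *\<^sub>R e \<omega> \<partial>solid_angle)"
    by (simp add: vec_eq_iff spatial_def H_eq comp[OF int_fe] e_comp c_def)
  have vK: "(\<Sum>i\<in>UNIV. v $ i * K $ Some i $ Some j)
      = (c *\<^sub>R (\<integral>\<omega>. (f \<omega> * (v \<bullet> e \<omega>)) *\<^sub>R e \<omega> \<partial>solid_angle)) $ j" for j
  proof -
    have int: "integrable solid_angle (\<lambda>\<omega>. f \<omega> * e \<omega> $ i * e \<omega> $ j)" for i
    proof -
      have "integrable solid_angle (\<lambda>\<omega>. f \<omega> * e \<omega> $ i)"
        using integrable_bounded_linear[OF bounded_linear_vec_nth int_fe] by simp
      from integrable_scaleR_bounded[OF this e_meas B] show ?thesis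
        using integrable_bounded_linear[OF bounded_linear_vec_nth] by fastforce
    qed
    have "(\<Sum>i\<in>UNIV. v $ i * K $ Some i $ Some j)
        = c * (\<integral>\<omega>. (\<Sum>i\<in>UNIV. v $ i * (f \<omega> * e \<omega> $ i * e \<omega> $ j)) \<partial>solid_angle)"
      using int by (simp add: K_eq e_comp c_def sum_distrib_left mult.left_commute)
    also have "(\<lambda>\<omega>. \<Sum>i\<in>UNIV. v $ i * (f \<omega> * e \<omega> $ i * e \<omega> $ j))
        = (\<lambda>\<omega>. ((f \<omega> * (v \<bullet> e \<omega>)) *\<^sub>R e \<omega>) $ j)"
      by (simp add: inner_vec_def sum_distrib_left sum_distrib_right mult_ac)
    finally show ?thesis by (simp add: comp[OF int_fvee])
  qed
  \<comment> \<open>By \<open>ve\<close>, the direction cosine times W is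
    \<open>v \<bullet> e \<omega>\<close>, so \<open>g\<close> combines the densities of J and of
    the contraction of H with v, and \<open>g\<close> times \<open>e\<close> those of H and of the
    contraction of K.\<close>
  have g_alt: "g \<omega> = c * ((W - lam * W) * f \<omega> - lam * (f \<omega> * (v \<bullet> e \<omega>)))" for \<omega>
    by (simp add: g_def ve algebra_simps)
  have g_nonneg: "0 \<le> g \<omega>" if "\<omega> \<in> angles" for \<omega>
  proof -
    have "lam * (1 + v \<bullet> direction \<omega>) \<le> lam * (1 + norm v)"
      using lambda vd[of \<omega>] by (intro mult_left_mono) auto
    also have "\<dots> \<le> inverse (1 + norm v) * (1 + norm v)"
      using lambda by (intro mult_right_mono) auto
    also have "\<dots> = 1" using norm_ge_zero[of v] by (simp add: add_nonneg_eq_0_iff)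
    finally show ?thesis unfolding g_def using c W f_nonneg[OF that] by simp
  qed
  have g_int: "integrable solid_angle g"
    unfolding g_alt[abs_def] using f_int int_fve by simp
  have int_g: "(\<integral>\<omega>. g \<omega> \<partial>solid_angle) = W * J - lam * (W * J + v \<bullet> spatial H)"
  proof -
    have "v \<bullet> spatial H = c * (\<integral>\<omega>. f \<omega> * (v \<bullet> e \<omega>) \<partial>solid_angle)"
      using integral_bounded_linear[OF bounded_linear_inner_right int_fe, of v] unfolding Hs by simp
    then show ?thesis
      unfolding g_alt using f_int int_fve by (simp add: J_eq[folded c_def] algebra_simps)
  qed
  define X where "X = (\<integral>\<omega>. g \<omega> *\<^sub>R e \<omega> \<partial>solid_angle)"
  have X_eq: "X = c *\<^sub>R ((W - lam * W) *\<^sub>R (\<integral>\<omega>. f \<omega> *\<^sub>R e \<omega> \<partial>solid_angle)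
      - lam *\<^sub>R (\<integral>\<omega>. (f \<omega> * (v \<bullet> e \<omega>)) *\<^sub>R e \<omega> \<partial>solid_angle))"
  proof -
    have "g \<omega> *\<^sub>R e \<omega> = c *\<^sub>R ((W - lam * W) *\<^sub>R (f \<omega> *\<^sub>R e \<omega>) - lam *\<^sub>R ((f \<omega> * (v \<bullet> e \<omega>)) *\<^sub>R e \<omega>))" for \<omega>
      by (simp add: g_alt scaleR_left_diff_distrib scaleR_right_diff_distrib right_diff_distrib mult.assoc)
    moreover have "(\<integral>\<omega>. c *\<^sub>R ((W - lam * W) *\<^sub>R p \<omega> - lam *\<^sub>R q \<omega>) \<partial>solid_angle)
        = c *\<^sub>R ((W - lam * W) *\<^sub>R (\<integral>\<omega>. p \<omega> \<partial>solid_angle) - lam *\<^sub>R (\<integral>\<omega>. q \<omega> \<partial>solid_angle))"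
      if "integrable solid_angle p" "integrable solid_angle q" for p q :: "real \<times> real \<Rightarrow> spacevec"
      using that by simp
    ultimately show ?thesis
      unfolding X_def using int_fe int_fvee by presburger
  qed
  have norm_X: "norm (rest_frame v X) \<le> (\<integral>\<omega>. g \<omega> \<partial>solid_angle)"
  proof -
    interpret bounded_linear "rest_frame v" by (rule bounded_linear_rest_frame)
    \<comment> \<open>Moving the linear map under the integral turns \<open>e\<close> into the unit
      vector \<open>direction\<close>, so the integrand has norm |g|.\<close>
    have "rest_frame v X = (\<integral>\<omega>. rest_frame v (g \<omega> *\<^sub>R e \<omega>) \<partial>solid_angle)"
      unfolding X_def
      by (rule integral_bounded_linear[OF bounded_linear_rest_frame, symmetric])
        (rule integrable_scaleR_bounded[OF g_int e_meas B])
    also have "\<dots> = (\<integral>\<omega>. g \<omega> *\<^sub>R direction \<omega> \<partial>solid_angle)"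
      by (simp add: scaleR e_def rest_frame_ell_low[OF v_less_1])
    also have "norm \<dots> \<le> (\<integral>\<omega>. norm (g \<omega> *\<^sub>R direction \<omega>) \<partial>solid_angle)"
      by (rule integral_norm_bound)
    \<comment> \<open>Nonnegativity of \<open>g\<close> is known on \<open>angles\<close>, which is
      the whole space of \<open>solid_angle\<close>.\<close>
    also have "\<dots> = (\<integral>\<omega>. g \<omega> \<partial>solid_angle)"
      using g_nonneg
      by (intro Bochner_Integration.integral_cong)
        (auto simp: norm_direction space_solid_angle)
    finally show ?thesis .
  qed
  define Dc where "Dc = W + lam * dtau * chi"
  define Dk where "Dk = W + lam * dtau * kappa"
  define EE where "EE = hat_energy v E F"
  define FF where "FF = spatial (hat_flux v E F)"
  have Dc: "0 < Dc" using W lambda dtau_nonneg opacities by (simp add: Dc_def add_pos_nonneg)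
  \<comment> \<open>Here \<open>chi \<le> kappa\<close> enters.\<close>
  have Dk: "Dc \<le> Dk" using lambda dtau_nonneg opacities by (simp add: Dc_def Dk_def mult_left_mono)
  have clear: "D * (x - lam * inverse D * y) = D * x - lam * y" if "0 < D" for D x y :: real
    using that by (simp add: right_diff_distrib)
  have J'_eq: "Dc * J' = (\<integral>\<omega>. g \<omega> \<partial>solid_angle) + lam * (EE + dtau * chi * J_Eq)"
  proof -
    have "Dc * J' = Dc * J - lam * (W * J + v \<bullet> spatial H - EE - dtau * chi * (J_Eq - J))"
      unfolding picard_J mu_chi_eq Dc_def[symmetric] EE_def using Dc by (rule clear)
    \<comment> \<open>The absorption term in \<open>Dc * J\<close> cancels the one in the bracket,
      leaving W J; likewise for \<open>kappa\<close> and H below.\<close>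
    then show ?thesis unfolding int_g by (simp add: Dc_def algebra_simps)
  qed
  have H'_eq: "Dk *\<^sub>R spatial H' = X + lam *\<^sub>R FF"
  proof -
    have "Dk * H' $ Some j = (X + lam *\<^sub>R FF) $ j" for j
    proof -
      have "Dk * H' $ Some j = Dk * H $ Some j - lam *
        (W * H $ Some j + (\<Sum>i\<in>UNIV. v $ i * K $ Some i $ Some j)
          - FF $ j + dtau * kappa * H $ Some j)"
        unfolding picard_H mu_kappa_eq Dk_def[symmetric] FF_def
        using Dc Dk by (subst clear) (simp_all add: spatial_def)
      moreover have "H $ Some j = (c *\<^sub>R (\<integral>\<omega>. f \<omega> *\<^sub>R e \<omega> \<partial>solid_angle)) $ j"
        using Hs by (simp add: spatial_def vec_eq_iff)
      ultimately show ?thesis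
        unfolding vK X_eq by (simp add: Dk_def algebra_simps)
    qed
    then show ?thesis by (simp add: vec_eq_iff spatial_def)
  qed
  have EE: "0 < EE" "norm (rest_frame v FF) \<le> EE"
    using hat_moments_realizable[OF v_less_1 eulerian realizable_U] by (simp_all add: EE_def FF_def)
  have source: "0 \<le> dtau * chi * J_Eq"
    using dtau_nonneg opacities J_Eq_nonneg by simp
  have "0 \<le> (\<integral>\<omega>. g \<omega> \<partial>solid_angle)"
    using norm_X norm_ge_zero order_trans by blast
  \<comment> \<open>The integral of \<open>g\<close> may vanish, for instance when
    \<open>v = 0\<close> and \<open>lam = 1\<close>; strict positivity comes from
    \<open>lam * EE\<close>.\<close>
  then have "0 < Dc * J'"
    unfolding J'_eq using EE source lambda by (simp add: add_nonneg_pos add_pos_nonneg)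
  then have J'_pos: "0 < J'" using Dc by (simp add: zero_less_mult_iff)
  interpret bounded_linear "rest_frame v" by (rule bounded_linear_rest_frame)
  have "Dc * norm (rest_frame v (spatial H')) \<le> Dk * norm (rest_frame v (spatial H'))"
    using Dk by (simp add: mult_right_mono)
  also have "\<dots> = norm (rest_frame v (Dk *\<^sub>R spatial H'))"
    using Dc Dk by (simp add: scaleR)
  also have "\<dots> \<le> norm (rest_frame v X) + lam * norm (rest_frame v FF)"
    unfolding H'_eq add scaleR using lambda norm_triangle_ineq[of "rest_frame v X" "lam *\<^sub>R rest_frame v FF"] by simp
  also have "\<dots> \<le> Dc * J'"
    unfolding J'_eq using norm_X EE source lambda by (intro add_mono mult_left_mono) auto
  finally have "norm (rest_frame v (spatial H')) \<le> J'"
    using Dc by simp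
  moreover have "orth_u v H'"
    using picard_H0 by (simp add: orth_u_def inner_vec_def spatial_def)
  ultimately show ?thesis
    using realizable_orth_iff[OF v_less_1] J'_pos by simp
qed

end
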